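(* Let $g\in\mathcal{F}_0$. For all integers $n,k\ge0$, the $(n,k)$-th term $\hat{t}_{n,k}$ of the inversion $(g(x),x)^!$ of the Appell array $(g(x),x)$ is given by $$\hat{t}_{n,k}=\frac{(-1)^k}{n+1}\binom{n+1}{k}\Bigl(\bigl(\operatorname{Rev}(xg(x))\bigr)',\;\operatorname{Rev}(xg(x))\Bigr)_{n,k}.$$ Moreover, $$\Bigl(\bigl(\operatorname{Rev}(xg(x))\bigr)',\;\operatorname{Rev}(xg(x))\Bigr)=\bigl((xg(x))',\;xg(x)\bigr)^{-1},$$ where the right-hand side is the inverse in the Riordan group (equivalently, the matrix inverse).
   Context: $R$ is a field of characteristic zero (for concreteness $R=\mathbb{Q}$). $\mathcal{F}_0$ is the set of formal power series $a_0+a_1x+a_2x^2+\cdots\in R[[x]]$ with $a_0\neq 0$, and $\mathcal{F}_1$ is the set of formal power series $a_1x+a_2x^2+\cdots\in R[[x]]$ with $a_1\ne 0$. For $h\in\mathcal{F}_1$, $\operatorname{Rev}(h(x))$ denotes the compositional inverse $\bar h$ of $h$, as a power series in $x$. A prime denotes the derivative with respect to $x$, and $[x^n]$ denotes extraction of the coefficient of $x^n$. A Riordan array $(u(x),v(x))$ with $u\in\mathcal{F}_0$, $v\in\mathcal{F}_1$ is the lower-triangular matrix with $(n,k)$-th entry $(u,v)_{n,k}=[x^n]u(x)v(x)^k$, $n,k\ge0$. Riordan arrays form a group under $(g,f)\cdot(u,v)=(g\cdot u(f),v(f))$ (which corresponds to matrix multiplication), with identity $(1,x)$ and inverse $(g,f)^{-1}=\left(\frac{1}{g(\bar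 f)},\bar f\right)$. An Appell array is a Riordan array of the form $(g(x),x)$. The inversion $(g(x),f(x))^!$ of a Riordan array is the array $(\hat{t}_{n,k})_{n,k\ge0}$ defined by $\sum_{n,k\ge0}\hat{t}_{n,k}x^ny^k=\frac1x\operatorname{Rev}_x\bigl(xG(x,y)\bigr)$, where $G(x,y)=\frac{g(x)}{1-yf(x)}\in R[y][[x]]$ and $\operatorname{Rev}_x$ denotes the compositional inverse in the variable $x$ (with $y$ fixed): $U(x,y)=\operatorname{Rev}_x(xG(x,y))$ is the unique series in $R[y][[x]]$ with $U(0,y)=0$ and $U(x,y)\,G(U(x,y),y)=x$. *)

theory Defs
  imports
    "HOL-Algebra.Group"
    "HOL-Computational_Algebra.Formal_Power_Series"
    "HOL-Computational_Algebra.Polynomial"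
begin

definition F0 :: "'a::field_char_0 fps set" where
  "F0 = {g. fps_nth g 0 \<noteq> 0}"

definition F1 :: "'a::field_char_0 fps set" where
  "F1 = {f. fps_nth f 0 = 0 \<and> fps_nth f 1 \<noteq> 0}"

subsection \<open>The Riordan group\<close>

type_synonym 'a inf_matrix = "nat \<Rightarrow> nat \<Rightarrow> 'a"

definition riordan :: "'a::field_char_0 fps \<Rightarrow> 'a fps \<Rightarrow> 'a inf_matrix" where
  "riordan u v = (\<lambda>n k. fps_nth (u * v ^ k) n)"

text \<open>
  The sum is cut off at the diagonal, so this is the matrix product only when the first factor
  is lower triangular, as every Riordan array is.
\<close>

definition lower_mult :: "'a::field_char_0 inf_matrix \<Rightarrow> 'a inf_matrix \<Rightarrow> 'a inf_matrix" where
  "lower_mult A B = (\<lambda>n k. \<Sum>j\<le>n. A n j * B j k)"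

definition riordan_group :: "'a::field_char_0 inf_matrix monoid" where
  "riordan_group =
     \<lparr>carrier = {riordan u v | u v. u \<in> F0 \<and> v \<in> F1},
      monoid.mult = lower_mult,
      one = (\<lambda>n k. if n = k then 1 else 0)\<rparr>"

lemma riordan_lower_triangular: "v \<in> F1 \<Longrightarrow> n < k \<Longrightarrow> riordan u v n k = 0"
  by (auto simp: riordan_def F1_def fps_mult_nth startsby_zero_power_prefix intro!: sum.neutral)

lemma riordan_one: "riordan 1 fps_X = (\<lambda>n k. if n = k then 1 else 0)"
  by (auto simp: riordan_def fun_eq_iff fps_X_power_nth)

lemma riordan_inject:
  assumes "u \<in> F0" "riordan u v = riordan u' v'"
  shows "u = u' \<and> v = v'"
proof -
  have *: "u * v ^ k = u' * v' ^ k" for k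
    using assms(2) by (auto simp: riordan_def fun_eq_iff fps_eq_iff)
  have "u = u'" using *[of 0] by simp
  moreover have "u \<noteq> 0" using assms(1) by (auto simp: F0_def)
  ultimately show ?thesis using *[of 1] by simp
qed

text \<open>The matrix product is the product given by composition of power series.\<close>

lemma riordan_mult:
  assumes "f \<in> F1"
  shows "lower_mult (riordan g f) (riordan u v) = riordan (g * (u oo f)) (v oo f)"
proof (intro ext)
  fix n k
  have f0: "fps_nth f 0 = 0" using assms by (simp add: F1_def)
  define w where "w = u * v ^ k"
  have prefix: "fps_nth (f ^ j) i = 0" if "i < j" for i j
    using startsby_zero_power_prefix[OF f0] that by blast
  have "riordan (g * (u oo f)) (v oo f) n k = fps_nth (g * (w oo f)) n"
    by (simp add: riordan_def w_def fps_compose_mult_distrib[OF f0] fps_compose_power[OF f0] mult.assoc)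
  also have "\<dots> = (\<Sum>i=0..n. fps_nth g i * fps_nth (w oo f) (n - i))"
    by (simp add: fps_mult_nth)
  also have "\<dots> = (\<Sum>i=0..n. fps_nth g i * (\<Sum>j=0..n. fps_nth w j * fps_nth (f ^ j) (n - i)))"
  proof (intro sum.cong refl arg_cong2[of _ _ _ _ times])
    fix i assume "i \<in> {0..n}"
    show "fps_nth (w oo f) (n - i) = (\<Sum>j=0..n. fps_nth w j * fps_nth (f ^ j) (n - i))"
      unfolding fps_compose_nth by (rule sum.mono_neutral_left) (auto simp: prefix)
  qed
  also have "\<dots> = (\<Sum>j=0..n. \<Sum>i=0..n. fps_nth g i * (fps_nth w j * fps_nth (f ^ j) (n - i)))"
    unfolding sum_distrib_left by (rule sum.swap)
  also have "\<dots> = (\<Sum>j=0..n. fps_nth (g * f ^ j) n * fps_nth w j)"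
    by (simp add: fps_mult_nth sum_distrib_left sum_distrib_right mult_ac)
  also have "\<dots> = lower_mult (riordan g f) (riordan u v) n k"
    by (simp add: lower_mult_def riordan_def w_def atMost_atLeast0)
  finally show "lower_mult (riordan g f) (riordan u v) n k = riordan (g * (u oo f)) (v oo f) n k" ..
qed

lemma F1_compose: "u \<in> F1 \<Longrightarrow> f \<in> F1 \<Longrightarrow> u oo f \<in> F1"
  by (simp add: F1_def fps_compose_nth)

lemma F0_compose: "g \<in> F0 \<Longrightarrow> u \<in> F0 \<Longrightarrow> g * (u oo f) \<in> F0"
  by (simp add: F0_def)

lemma F1_inv:
  assumes "f \<in> F1"
  shows "fps_inv f \<in> F1" "f oo fps_inv f = fps_X" "fps_inv f oo f = fps_X"
proof -
  have f: "fps_nth f 0 = 0" "fps_nth f 1 \<noteq> 0" using assms by (auto simp: F1_def)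
  show r: "f oo fps_inv f = fps_X" and "fps_inv f oo f = fps_X"
    using fps_inv_right[OF f] fps_inv[OF f] by auto
  have "fps_nth (f oo fps_inv f) 1 = 1" by (simp add: r)
  then show "fps_inv f \<in> F1"
    using f by (auto simp: F1_def fps_inv_def fps_compose_nth)
qed

lemma group_riordan: "group (riordan_group :: 'a::field_char_0 inf_matrix monoid)"
proof (rule groupI)
  fix A B C :: "'a inf_matrix"
  have X: "fps_X \<in> (F1 :: 'a fps set)" "1 \<in> (F0 :: 'a fps set)"
    by (simp_all add: F1_def F0_def)
  show "\<one>\<^bsub>riordan_group\<^esub> \<in> carrier (riordan_group :: 'a inf_matrix monoid)"
    using X by (auto simp: riordan_group_def riordan_one[symmetric])
  assume "A \<in> carrier riordan_group"
  then obtain g f where A: "A = riordan g f" and gf: "g \<in> F0" "f \<in> F1"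
    by (auto simp: riordan_group_def)
  have f0: "fps_nth f 0 = 0" using gf by (simp add: F1_def)
  show "\<one>\<^bsub>riordan_group\<^esub> \<otimes>\<^bsub>riordan_group\<^esub> A = A"
    using riordan_mult[OF X(1), of 1 g f] by (simp add: riordan_group_def A riordan_one)
  show "\<exists>B\<in>carrier riordan_group. B \<otimes>\<^bsub>riordan_group\<^esub> A = \<one>\<^bsub>riordan_group\<^esub>"
  proof
    let ?h = "fps_inv f"
    have h: "?h \<in> F1" "f oo ?h = fps_X" using F1_inv[OF gf(2)] by auto
    have g0: "fps_nth (g oo ?h) 0 \<noteq> 0" using gf by (simp add: F0_def)
    show "riordan (inverse (g oo ?h)) ?h \<otimes>\<^bsub>riordan_group\<^esub> A = \<one>\<^bsub>riordan_group\<^esub>"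
      using riordan_mult[OF h(1), of "inverse (g oo ?h)" g f] g0
      by (simp add: riordan_group_def A h(2) riordan_one inverse_mult_eq_1)
    show "riordan (inverse (g oo ?h)) ?h \<in> carrier riordan_group"
      using h(1) g0
      by (simp add: riordan_group_def F0_def)
        (intro exI[of _ "inverse (g oo ?h)"] exI[of _ ?h], simp)
  qed
  assume "B \<in> carrier riordan_group"
  then obtain u v where B: "B = riordan u v" and uv: "u \<in> F0" "v \<in> F1"
    by (auto simp: riordan_group_def)
  have v0: "fps_nth v 0 = 0" using uv by (simp add: F1_def)
  show "A \<otimes>\<^bsub>riordan_group\<^esub> B \<in> carrier riordan_group"
    using gf uv by (auto simp: riordan_group_def A B riordan_mult intro!: F0_compose F1_compose)
  assume "C \<in> carrier riordan_group"
  then obtain r s where C: "C = riordan r s"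
    by (auto simp: riordan_group_def)
  show "A \<otimes>\<^bsub>riordan_group\<^esub> B \<otimes>\<^bsub>riordan_group\<^esub> C =
        A \<otimes>\<^bsub>riordan_group\<^esub> (B \<otimes>\<^bsub>riordan_group\<^esub> C)"
    using gf uv f0 v0
    by (simp add: riordan_group_def A B C riordan_mult F1_compose
        fps_compose_mult_distrib fps_compose_assoc mult.assoc)
qed

subsection \<open>Compositional inverse over a ring of coefficients\<close>

text \<open>
  The library's \<^term>\<open>fps_inv\<close> requires coefficients in a field, which excludes polynomials.
\<close>

definition fps_rev :: "'a::comm_ring_1 fps \<Rightarrow> 'a fps" where
  "fps_rev h = (THE U. fps_nth U 0 = 0 \<and> h oo U = fps_X)"

lemma fps_left_rev_exists:
  fixes h :: "'a::idom fps"
  assumes h0: "fps_nth h 0 = 0" and c: "c * fps_nth h 1 = 1"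
  shows "\<exists>L. fps_nth L 0 = 0 \<and> fps_nth L 1 = c \<and> L oo h = fps_X"
proof -
  define l where
    "l = wfrec less_than
       (\<lambda>l n. c ^ n * (fps_nth fps_X n - (\<Sum>i<n. l i * fps_nth (h ^ i) n)))"
  have l: "l n = c ^ n * (fps_nth fps_X n - (\<Sum>i<n. l i * fps_nth (h ^ i) n))" for n
  proof -
    have "l n = c ^ n * (fps_nth fps_X n - (\<Sum>i<n. cut l less_than n i * fps_nth (h ^ i) n))"
      unfolding l_def by (rule trans[OF wfrec[OF wf_less_than]]) (rule refl)
    then show ?thesis by (simp add: cut_def)
  qed
  have nth: "fps_nth (Abs_fps l oo h) n = fps_nth fps_X n" for n
  proof -
    have "fps_nth (Abs_fps l oo h) n = (\<Sum>i<n. l i * fps_nth (h ^ i) n) + l n * fps_nth h 1 ^ n"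
      by (simp add: fps_compose_nth startsby_zero_power_nth_same[OF h0]
          flip: atMost_atLeast0 lessThan_Suc_atMost)
    also have "l n * fps_nth h 1 ^ n =
        (c * fps_nth h 1) ^ n * (fps_nth fps_X n - (\<Sum>i<n. l i * fps_nth (h ^ i) n))"
      by (subst l) (simp add: power_mult_distrib mult_ac)
    finally show ?thesis unfolding c by simp
  qed
  have "l 0 = 0" by (subst l) simp
  moreover from this have "l 1 = c" by (subst l) simp
  ultimately show ?thesis
    using nth by (intro exI[of _ "Abs_fps l"]) (simp add: fps_eq_iff)
qed

lemma fps_rev_ex1:
  fixes h :: "'a::idom fps"
  assumes h0: "fps_nth h 0 = 0" and c: "c * fps_nth h 1 = 1"
  shows "\<exists>!U. fps_nth U 0 = 0 \<and> h oo U = fps_X"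
proof -
  obtain L where L: "fps_nth L 0 = 0" "fps_nth L 1 = c" "L oo h = fps_X"
    using fps_left_rev_exists[OF assms] by blast
  obtain M where M: "fps_nth M 0 = 0" "M oo L = fps_X"
    using fps_left_rev_exists[of L "fps_nth h 1"] L c by (auto simp: mult.commute)
  have "M = M oo (L oo h)" by (simp add: L(3))
  also have "\<dots> = h"
    by (simp add: fps_compose_assoc[OF h0 L(1)] M(2) fps_X_fps_compose_startby0[OF h0])
  finally have "h oo L = fps_X" using M(2) by simp
  moreover have "U = L" if "fps_nth U 0 = 0" "h oo U = fps_X" for U
  proof -
    have "U = (L oo h) oo U" by (simp add: L(3) fps_X_fps_compose_startby0[OF that(1)])
    also have "\<dots> = L" by (simp add: that fps_compose_assoc[OF that(1) h0, symmetric])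
    finally show ?thesis .
  qed
  ultimately show ?thesis using L(1) by blast
qed

lemma fps_rev_eq_fps_inv:
  fixes h :: "'a::field_char_0 fps"
  assumes "h \<in> F1"
  shows "fps_rev h = fps_inv h"
proof -
  have "fps_nth h 0 = 0" "inverse (fps_nth h 1) * fps_nth h 1 = 1"
    using assms by (auto simp: F1_def)
  then show ?thesis
    unfolding fps_rev_def using F1_inv[OF assms]
    by (intro the1_equality fps_rev_ex1) (auto simp: F1_def)
qed

subsection \<open>Inversion of a Riordan array\<close>

text \<open>
  Bivariate series are elements of \<open>R[y][[x]]\<close>, that is, of type \<^typ>\<open>'a poly fps\<close>: the
  polynomial variable is \<open>y\<close> and the series variable is \<open>x\<close>.
\<close>

definition const_y :: "'a::field_char_0 fps \<Rightarrow> 'a poly fps" where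
  "const_y h = Abs_fps (\<lambda>n. [:fps_nth h n:])"

text \<open>
  In \<open>g(x) / (1 - y f(x))\<close> the denominator has constant term 1, whose inverse 1 seeds
  \<open>fps_right_inverse\<close>; \<open>[:0, 1:]\<close> is \<open>y\<close>.
\<close>

definition riordan_gf :: "'a::field_char_0 fps \<Rightarrow> 'a fps \<Rightarrow> 'a poly fps" where
  "riordan_gf g f = const_y g * fps_right_inverse (1 - fps_const [:0, 1:] * const_y f) 1"

definition riordan_inversion :: "'a::field_char_0 fps \<Rightarrow> 'a fps \<Rightarrow> 'a inf_matrix" where
  "riordan_inversion g f =
     (\<lambda>n k. coeff (fps_nth (fps_shift 1 (fps_rev (fps_X * riordan_gf g f))) n) k)"

lemma riordan_gf_mult:
  assumes "f \<in> F1"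
  shows "riordan_gf g f * (1 - fps_const [:0, 1:] * const_y f) = const_y g"
proof -
  let ?d = "1 - fps_const [:0, 1:] * const_y f"
  have "fps_nth ?d 0 * 1 = 1" using assms by (simp add: const_y_def F1_def)
  from fps_right_inverse[OF this] show ?thesis
    by (simp add: riordan_gf_def mult_ac)
qed

lemma fps_rev_riordan_gf:
  fixes g f :: "'a::field_char_0 fps"
  assumes "g \<in> F0" "f \<in> F1"
  defines "U \<equiv> fps_rev (fps_X * riordan_gf g f)"
  shows "fps_nth U 0 = 0" "U * (riordan_gf g f oo U) = fps_X"
    and "\<And>V. fps_nth V 0 = 0 \<Longrightarrow> V * (riordan_gf g f oo V) = fps_X \<Longrightarrow> V = U"
proof -
  let ?h = "fps_X * riordan_gf g f"
  have "[:inverse (fps_nth g 0):] * fps_nth ?h 1 = 1"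
    using assms by (simp add: riordan_gf_def const_y_def F0_def)
  then have ex1: "\<exists>!U. fps_nth U 0 = 0 \<and> ?h oo U = fps_X"
    by (intro fps_rev_ex1[of ?h "[:inverse (fps_nth g 0):]"]) simp_all
  have eq: "?h oo V = V * (riordan_gf g f oo V)" if "fps_nth V 0 = 0" for V
    by (simp add: fps_compose_mult_distrib[OF that] fps_X_fps_compose_startby0[OF that])
  show U0: "fps_nth U 0 = 0" and "U * (riordan_gf g f oo U) = fps_X"
    using theI'[OF ex1] eq[of U] by (auto simp: U_def fps_rev_def)
  show "V = U" if "fps_nth V 0 = 0" "V * (riordan_gf g f oo V) = fps_X" for V
    unfolding U_def fps_rev_def using that eq[of V] by (intro the1_equality[OF ex1, symmetric]) auto
qed

end

theory Submission
  imports Defs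
begin

text \<open>
  Specialising \<open>y\<close> to a scalar \<open>c\<close> turns the inversion of \<open>(g, x)\<close> into the compositional inverse
  of \<open>x g / (1 - c x)\<close>. By Lagrange inversion its coefficient at \<open>x\<^sup>n\<^sup>+\<^sup>1\<close> is
  \<open>1 / (n + 1)\<close> times \<open>[x\<^sup>n] (1 - c x)\<^sup>n\<^sup>+\<^sup>1 / g\<^sup>n\<^sup>+\<^sup>1\<close>, a polynomial in \<open>c\<close> whose \<open>k\<close>-th
  coefficient contains \<open>[x\<^sup>n] x\<^sup>k / g\<^sup>n\<^sup>+\<^sup>1\<close>. By Lagrange inversion again, the latter is
  \<open>[x\<^sup>n] h' h\<^sup>k\<close> for \<open>h = Rev(x g)\<close>. Since the field is infinite, the values at all \<open>c\<close>
  determine the polynomial in \<open>y\<close>.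
\<close>

subsection \<open>Lagrange inversion\<close>

lemma fps_deriv_power_Suc:
  fixes u :: "'a::comm_ring_1 fps"
  shows "fps_deriv (u ^ Suc k) = fps_const (of_nat (Suc k)) * (fps_deriv u * u ^ k)"
  unfolding fps_deriv_power by (simp add: mult.assoc flip: fps_of_nat)

text \<open>
  Up to a shift, this says that \<open>F' / F\<^sup>j\<^sup>+\<^sup>1\<close> with \<open>F = x p\<close> has residue 1 for \<open>j = 0\<close>
  and residue 0 otherwise.
\<close>

lemma fps_deriv_mult_inverse_power_nth:
  fixes p :: "'a::field_char_0 fps"
  assumes "fps_nth p 0 \<noteq> 0"
  shows "fps_nth (fps_deriv (fps_X * p) * inverse p ^ Suc j) j = (if j = 0 then 1 else 0)"
proof (cases j)
  case 0
  then show ?thesis using assms by simp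
next
  case (Suc i)
  let ?q = "inverse p"
  have pq: "p * ?q = 1" using assms by (simp add: inverse_mult_eq_1')
  have "fps_deriv (p * ?q) = 0" by (simp only: pq fps_deriv_1)
  \<comment> \<open>Since \<open>p' q = - p q'\<close>, the series becomes
    \<open>q^j - x q' q^(j-1)\<close>. As \<open>q' q^(j-1) = (q^j)' / j\<close>, both terms have
    the same coefficient at \<open>x^j\<close>.\<close>
  then have "p * fps_deriv ?q + fps_deriv p * ?q = 0" by simp
  then have dp: "fps_deriv p * ?q = - (p * fps_deriv ?q)" by (simp add: eq_neg_iff_add_eq_0 add.commute)
  have "fps_deriv (fps_X * p) * ?q ^ Suc j
      = (p * ?q) * ?q ^ j + fps_X * (fps_deriv p * ?q) * ?q ^ j"
    by (simp add: algebra_simps)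
  also have "\<dots> = p * ?q * ?q ^ j - fps_X * (p * ?q * (fps_deriv ?q * ?q ^ i))"
    unfolding dp Suc by (simp add: mult_ac)
  also have "\<dots> = ?q ^ j - fps_X * (fps_deriv ?q * ?q ^ i)"
    by (simp only: pq mult_1_left)
  finally have eq: "fps_deriv (fps_X * p) * ?q ^ Suc j = ?q ^ j - fps_X * (fps_deriv ?q * ?q ^ i)" .
  have "of_nat j * fps_nth (fps_deriv ?q * ?q ^ i) i = fps_nth (fps_deriv (?q ^ j)) i"
    by (simp only: Suc fps_deriv_power_Suc fps_mult_left_const_nth)
  also have "\<dots> = of_nat j * fps_nth (?q ^ j) j"
    by (simp only: Suc fps_deriv_nth Suc_eq_plus1)
  finally have "fps_nth (fps_deriv ?q * ?q ^ i) i = fps_nth (?q ^ j) j"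
    by (simp only: mult_cancel_left of_nat_eq_0_iff) (simp add: Suc)
  then show ?thesis unfolding eq by (simp add: Suc)
qed

text \<open>By the chain rule, \<open>(P oo F)'\<close> with \<open>F = x p\<close> is
  \<open>F'\<close> times the sum of \<open>(j+1) P_(j+1) F^j\<close>. Terms with
  \<open>j > n\<close> do not reach \<open>x^n\<close>, and those with \<open>j < n\<close> have
  residue 0.\<close>

lemma lagrange_inversion:
  fixes p P :: "'a::field_char_0 fps"
  assumes p: "fps_nth p 0 \<noteq> 0"
  shows "of_nat (Suc n) * fps_nth P (Suc n)
    = fps_nth (fps_deriv (P oo (fps_X * p)) * inverse p ^ Suc n) n"
proof -
  let ?F = "fps_X * p" and ?q = "inverse p"
  have F: "?F \<in> F1" using p by (simp add: F1_def)
  have pq: "p * ?q = 1" using p by (simp add: inverse_mult_eq_1')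
  have nth: "fps_nth (fps_deriv ?F * ?q ^ Suc n * ?F ^ j) n = (if j = n then 1 else 0)"
    if "j \<le> n" for j
  proof -
    \<comment> \<open>The factor \<open>p^j\<close> of \<open>F^j\<close> cancels
      \<open>q^j\<close>, and \<open>x^j\<close> lowers the index to \<open>n - j\<close>, where the
      residue is known.\<close>
    have "?q ^ Suc n = ?q ^ Suc (n - j) * ?q ^ j"
      using that by (simp flip: power_add)
    then have "fps_deriv ?F * ?q ^ Suc n * ?F ^ j
        = fps_X ^ j * (fps_deriv ?F * ?q ^ Suc (n - j)) * (p * ?q) ^ j"
      by (simp only: power_mult_distrib mult_ac)
    also have "\<dots> = fps_X ^ j * (fps_deriv ?F * ?q ^ Suc (n - j))"
      by (simp add: pq)
    finally show ?thesis
      using that fps_deriv_mult_inverse_power_nth[OF p, of "n - j"]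
      by (simp only: fps_X_power_mult_nth) auto
  qed
  \<comment> \<open>Column 0 of a Riordan product expands the composition with \<open>F\<close> into
    a finite sum over powers of \<open>F\<close>.\<close>
  have "fps_nth (fps_deriv (P oo ?F) * ?q ^ Suc n) n
      = riordan (fps_deriv ?F * ?q ^ Suc n * (fps_deriv P oo ?F)) (fps_X oo ?F) n 0"
    by (simp add: riordan_def fps_compose_deriv mult_ac)
  also have "\<dots> = (\<Sum>j\<le>n. fps_nth (fps_deriv ?F * ?q ^ Suc n * ?F ^ j) n * fps_nth (fps_deriv P) j)"
    unfolding riordan_mult[OF F, symmetric] by (simp only: lower_mult_def) (simp add: riordan_def)
  also have "\<dots> = (\<Sum>j\<le>n. if j = n then fps_nth (fps_deriv P) j else 0)"
    by (intro sum.cong refl) (simp only: nth atMost_iff, simp)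
  also have "\<dots> = of_nat (Suc n) * fps_nth P (Suc n)"
    by simp
  finally show ?thesis ..
qed

text \<open>For \<open>h = Rev(x p)\<close>, \<open>h' h^k\<close> is
  \<open>(h^(k+1))' / (k+1)\<close>, and Lagrange inversion applies to \<open>P = h^(k+1)\<close>
  because \<open>P oo (x p) = x^(k+1)\<close>.\<close>

lemma riordan_fps_inv_nth:
  fixes p :: "'a::field_char_0 fps"
  assumes "p \<in> F0"
  shows "riordan (fps_deriv (fps_inv (fps_X * p))) (fps_inv (fps_X * p)) n k
    = fps_nth (fps_X ^ k * inverse p ^ Suc n) n"
proof -
  let ?F = "fps_X * p"
  let ?h = "fps_inv ?F"
  have p: "fps_nth p 0 \<noteq> 0" using assms by (simp add: F0_def)
  then have F: "?F \<in> F1" by (simp add: F1_def)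
  have "?h ^ Suc k oo ?F = (?h oo ?F) ^ Suc k"
    by (rule fps_compose_power[symmetric]) simp
  then have comp: "?h ^ Suc k oo ?F = fps_X ^ Suc k"
    by (simp only: F1_inv(3)[OF F])
  have "of_nat (Suc k) * fps_nth (fps_deriv ?h * ?h ^ k) n = fps_nth (fps_deriv (?h ^ Suc k)) n"
    by (simp only: fps_deriv_power_Suc fps_mult_left_const_nth)
  also have "\<dots> = of_nat (Suc n) * fps_nth (?h ^ Suc k) (Suc n)"
    by (simp only: fps_deriv_nth Suc_eq_plus1)
  also have "\<dots> = fps_nth (fps_deriv (fps_X ^ Suc k) * inverse p ^ Suc n) n"
    unfolding lagrange_inversion[OF p] comp ..
  also have "\<dots> = of_nat (Suc k) * fps_nth (fps_X ^ k * inverse p ^ Suc n) n"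
    by (simp only: fps_deriv_power_Suc mult.assoc fps_mult_left_const_nth fps_deriv_fps_X mult_1_left)
  finally show ?thesis
    by (simp only: riordan_def mult_cancel_left of_nat_eq_0_iff) simp
qed

subsection \<open>Specialisation of the second variable\<close>

text \<open>A ring homomorphism commuting with composition; it carries identities of
  \<open>R[y][[x]]\<close> to series over the field, where Lagrange inversion is available.\<close>

definition fps_eval_y :: "'a::field_char_0 \<Rightarrow> 'a poly fps \<Rightarrow> 'a fps" where
  "fps_eval_y c A = Abs_fps (\<lambda>n. poly (fps_nth A n) c)"

lemma fps_nth_eval_y [simp]: "fps_nth (fps_eval_y c A) n = poly (fps_nth A n) c"
  by (simp add: fps_eval_y_def)

lemma fps_eval_y_mult: "fps_eval_y c (A * B) = fps_eval_y c A * fps_eval_y c B"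
  by (simp add: fps_eq_iff fps_mult_nth poly_sum)

lemma fps_eval_y_power: "fps_eval_y c (A ^ k) = fps_eval_y c A ^ k"
  by (induction k) (simp_all add: fps_eval_y_mult, simp add: fps_eq_iff)

lemma fps_eval_y_compose: "fps_eval_y c (A oo B) = fps_eval_y c A oo fps_eval_y c B"
  by (simp add: fps_eq_iff fps_compose_nth poly_sum flip: fps_eval_y_power)

lemma fps_eval_y_X [simp]: "fps_eval_y c fps_X = fps_X"
  by (simp add: fps_eq_iff)

lemma fps_eval_y_riordan_gf_X:
  "fps_eval_y c (riordan_gf g fps_X) = g * inverse (1 - fps_const c * fps_X)"
proof -
  let ?d = "1 - fps_const c * fps_X"
  let ?G = "fps_eval_y c (riordan_gf g fps_X)"
  have "fps_X \<in> (F1 :: 'a fps set)" by (simp add: F1_def)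
  from arg_cong[OF riordan_gf_mult[OF this], of "fps_eval_y c"]
  have "?G * fps_eval_y c (1 - fps_const [:0, 1:] * const_y fps_X) = fps_eval_y c (const_y g)"
    unfolding fps_eval_y_mult .
  moreover have "fps_eval_y c (const_y g) = g"
    by (simp add: fps_eq_iff const_y_def)
  moreover have "fps_eval_y c (1 - fps_const [:0, 1:] * const_y fps_X) = ?d"
    by (simp add: fps_eq_iff const_y_def)
  ultimately have "?G * ?d = g" by simp
  moreover have "?d * inverse ?d = 1" by (simp add: inverse_mult_eq_1')
  ultimately show ?thesis by (metis mult.assoc mult.right_neutral)
qed

text \<open>The equation defining the reversion survives evaluation at \<open>c\<close>, so the
  result is a right compositional inverse, which must coincide with the left inverse
  \<open>fps_inv\<close>.\<close>

lemma fps_eval_y_rev_riordan_gf_X: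
  fixes g :: "'a::field_char_0 fps"
  assumes "g \<in> F0"
  shows "fps_eval_y c (fps_rev (fps_X * riordan_gf g fps_X))
    = fps_inv (fps_X * (g * inverse (1 - fps_const c * fps_X)))"
proof -
  let ?U = "fps_rev (fps_X * riordan_gf g fps_X)"
  let ?G = "g * inverse (1 - fps_const c * fps_X)"
  let ?V = "fps_eval_y c ?U"
  have "fps_X \<in> (F1 :: 'a fps set)" by (simp add: F1_def)
  note U = fps_rev_riordan_gf[OF assms this]
  have V0: "fps_nth ?V 0 = 0" using U(1) by simp
  have "?V * (?G oo ?V) = fps_X"
    using arg_cong[OF U(2), of "fps_eval_y c"]
    by (simp add: fps_eval_y_mult fps_eval_y_compose fps_eval_y_riordan_gf_X)
  then have comp: "fps_X * ?G oo ?V = fps_X"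
    by (simp add: fps_compose_mult_distrib[OF V0] fps_X_fps_compose_startby0[OF V0])
  have F: "fps_X * ?G \<in> F1" using assms by (simp add: F1_def F0_def)
  then have F0: "fps_nth (fps_X * ?G) 0 = 0" by simp
  have "?V = (fps_inv (fps_X * ?G) oo (fps_X * ?G)) oo ?V"
    by (simp add: F1_inv(3)[OF F] fps_X_fps_compose_startby0[OF V0])
  also have "\<dots> = fps_inv (fps_X * ?G) oo (fps_X * ?G oo ?V)"
    by (rule fps_compose_assoc[OF V0 F0, symmetric])
  also have "\<dots> = fps_inv (fps_X * ?G)" unfolding comp by simp
  finally show ?thesis .
qed

subsection \<open>The inversion of an Appell array\<close>

lemma riordan_inversion_Appell_nth:
  fixes g :: "'a::field_char_0 fps"
  assumes g: "g \<in> F0"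
  shows "riordan_inversion g fps_X n k
    = (- 1) ^ k / of_nat (Suc n) * of_nat (Suc n choose k) * fps_nth (fps_X ^ k * inverse g ^ Suc n) n"
proof -
  define a where "a k = (- 1) ^ k / of_nat (Suc n) * of_nat (Suc n choose k) *
    fps_nth (fps_X ^ k * inverse g ^ Suc n) n" for k
  \<comment> \<open>The index is \<open>Suc n\<close> because the inversion divides the reversion by
    \<open>x\<close>.\<close>
  let ?u = "fps_nth (fps_rev (fps_X * riordan_gf g fps_X)) (Suc n)"
  have "poly ?u c = poly (\<Sum>i\<le>Suc n. monom (a i) i) c" for c
  proof -
    let ?d = "1 - fps_const c * fps_X :: 'a fps"
    let ?p = "g * inverse ?d"
    have p: "fps_nth ?p 0 \<noteq> 0" using g by (simp add: F0_def)
    then have p': "?p \<in> F0" by (simp add: F0_def)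
    have d: "fps_nth ?d 0 \<noteq> 0" by simp
    have "inverse (inverse ?d) = ?d" by (rule fps_inverse_idempotent[OF d])
    then have ip: "inverse ?p = ?d * inverse g" by (simp add: fps_inverse_mult mult.commute)
    have "of_nat (Suc n) * poly ?u c = of_nat (Suc n) * fps_nth (fps_inv (fps_X * ?p)) (Suc n)"
      by (simp only: fps_eval_y_rev_riordan_gf_X[OF g] flip: fps_nth_eval_y)
    \<comment> \<open>The factor \<open>n + 1\<close> turns the coefficient of the reversion at
      \<open>x^(n+1)\<close> into that of its derivative at \<open>x^n\<close>, an entry of column
      0.\<close>
    also have "\<dots> = riordan (fps_deriv (fps_inv (fps_X * ?p))) (fps_inv (fps_X * ?p)) n 0"
      by (simp add: riordan_def)
    also have "\<dots> = fps_nth (?d ^ Suc n * inverse g ^ Suc n) n"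
      unfolding riordan_fps_inv_nth[OF p'] ip power_mult_distrib by simp
    also have "?d ^ Suc n = (\<Sum>i\<le>Suc n. of_nat (Suc n choose i) * (fps_const (- c) * fps_X) ^ i)"
      using binomial_ring[of "fps_const (- c) * fps_X" 1 "Suc n"]
      by (simp add: algebra_simps del: power_Suc sum.atMost_Suc flip: fps_const_neg)
    also have "\<dots> = (\<Sum>i\<le>Suc n. fps_const (of_nat (Suc n choose i) * (- c) ^ i) * fps_X ^ i)"
      by (simp only: fps_of_nat[symmetric] power_mult_distrib fps_const_power mult.assoc[symmetric]
          fps_const_mult)
    also have "fps_nth (\<dots> * inverse g ^ Suc n) n
        = (\<Sum>i\<le>Suc n. of_nat (Suc n choose i) * (- c) ^ i * fps_nth (fps_X ^ i * inverse g ^ Suc n) n)"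
      by (simp only: sum_distrib_right fps_sum_nth mult.assoc fps_mult_left_const_nth)
    also have "\<dots> = (\<Sum>i\<le>Suc n. of_nat (Suc n) * (a i * c ^ i))"
    proof (intro sum.cong refl)
      fix i
      have "(- c) ^ i = (- 1) ^ i * c ^ i" by (simp flip: power_mult_distrib)
      moreover have "of_nat (Suc n) \<noteq> (0 :: 'a)" by (simp only: of_nat_eq_0_iff nat.simps not_False_eq_True)
      ultimately show "of_nat (Suc n choose i) * (- c) ^ i * fps_nth (fps_X ^ i * inverse g ^ Suc n) n
          = of_nat (Suc n) * (a i * c ^ i)"
        by (simp add: a_def del: of_nat_Suc power_Suc)
    qed
    also have "\<dots> = of_nat (Suc n) * poly (\<Sum>i\<le>Suc n. monom (a i) i) c"
      by (simp only: sum_distrib_left poly_sum poly_monom)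
    finally show ?thesis by (simp only: mult_cancel_left of_nat_eq_0_iff) simp
  qed
  then have u: "?u = (\<Sum>i\<le>Suc n. monom (a i) i)"
    by (simp only: poly_eq_poly_eq_iff[symmetric] fun_eq_iff) blast
  \<comment> \<open>Beyond degree \<open>n + 1\<close> the sum has no monomials, and the binomial
    makes the formula vanish as well.\<close>
  have "a k = 0" if "k > Suc n"
    using that by (simp add: a_def)
  then have "coeff ?u k = a k"
    unfolding u coeff_sum coeff_monom
    by (auto simp: sum.delta not_le simp del: sum.atMost_Suc)
  then show ?thesis
    by (simp add: riordan_inversion_def a_def)
qed

text \<open>With \<open>h = Rev f\<close>, the chain rule gives
  \<open>h' (f' oo h) = (f oo h)' = 1\<close>, so the product is the identity array; in a group a
  left inverse is the inverse.\<close>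

lemma riordan_inv_deriv:
  fixes f :: "'a::field_char_0 fps"
  assumes f: "f \<in> F1"
  shows "inv\<^bsub>riordan_group\<^esub> (riordan (fps_deriv f) f) = riordan (fps_deriv (fps_inv f)) (fps_inv f)"
proof -
  interpret group "riordan_group :: 'a inf_matrix monoid" by (rule group_riordan)
  have deriv: "fps_deriv u \<in> F0" if "u \<in> F1" for u :: "'a fps"
    using that by (simp add: F0_def F1_def)
  have carrier: "riordan (fps_deriv u) u \<in> carrier riordan_group" if "u \<in> F1" for u :: "'a fps"
    using deriv[OF that] that by (auto simp: riordan_group_def)
  note h = F1_inv[OF f]
  have "fps_deriv (fps_inv f) * (fps_deriv f oo fps_inv f) = fps_deriv (f oo fps_inv f)"
    using h(1) by (simp add: fps_compose_deriv F1_def mult.commute)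
  then have "fps_deriv (fps_inv f) * (fps_deriv f oo fps_inv f) = 1"
    by (simp add: h(2))
  then have "riordan (fps_deriv (fps_inv f)) (fps_inv f) \<otimes>\<^bsub>riordan_group\<^esub> riordan (fps_deriv f) f
      = \<one>\<^bsub>riordan_group\<^esub>"
    using riordan_mult[OF h(1), of "fps_deriv (fps_inv f)" "fps_deriv f" f]
    by (simp add: riordan_group_def h(2) riordan_one)
  then show ?thesis
    using carrier[OF f] carrier[OF h(1)] by (rule inv_equality)
qed

theorem corollary9:
  fixes g :: "'a::field_char_0 fps"
  assumes "g \<in> F0"
  shows "(\<forall>n k. riordan_inversion g fps_X n k =
            (- 1) ^ k / of_nat (n + 1) * of_nat ((n + 1) choose k) *
            riordan (fps_deriv (fps_inv (fps_X * g))) (fps_inv (fps_X * g)) n k) \<and>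
         riordan (fps_deriv (fps_inv (fps_X * g))) (fps_inv (fps_X * g)) =
           inv\<^bsub>riordan_group\<^esub> (riordan (fps_deriv (fps_X * g)) (fps_X * g))"
proof -
  have "fps_X * g \<in> F1" using assms by (simp add: F0_def F1_def)
  \<comment> \<open>Both the inversion and the Riordan entry reduce to the coefficient of
    \<open>x^k / g^(n+1)\<close> at \<open>x^n\<close>.\<close>
  then show ?thesis
    using riordan_inv_deriv[of "fps_X * g"]
    by (simp only: riordan_inversion_Appell_nth[OF assms] riordan_fps_inv_nth[OF assms]
        Suc_eq_plus1 simp_thms)
qed

end
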